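(* Let $c$ be a nonzero integer with $|c|\leq 10^{12}$, and let $f(z)=z^3+\frac{1}{c}\in\mathbb{Q}[z]$. If $f(z)$ is reducible over $\mathbb{Q}$, then for every integer $n\geq 1$ the iterate $f^n(z)$ has exactly two irreducible factors over $\mathbb{Q}$.
   Context: For a polynomial $f$, $f^n$ denotes the $n$-th iterate under composition: $f^1=f$ and $f^n(z)=f(f^{n-1}(z))$. *)

theory Defs
  imports Complex_Main "HOL-Computational_Algebra.Polynomial"
begin

primrec poly_iterate :: "'a::comm_semiring_1 poly \<Rightarrow> nat \<Rightarrow> 'a poly" where
  "poly_iterate f 0 = [:0, 1:]"
| "poly_iterate f (Suc n) = pcompose f (poly_iterate f n)"

lemma poly_iterate_1: "poly_iterate f 1 = f"
  by (simp add: pcompose_idR)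

lemma poly_poly_iterate: "poly (poly_iterate f n) x = (poly f ^^ n) x"
  by (induction n) (simp_all add: poly_pcompose)

text \<open>Irreducible factors are counted with multiplicity, and the two factors are moreover
  not associated, so the number of distinct ones is also two.\<close>

definition exactly_two_irreducible_factors :: "'a::comm_semiring_1 poly \<Rightarrow> bool" where
  "exactly_two_irreducible_factors p \<longleftrightarrow>
    (\<exists>g h. irreducible g \<and> irreducible h \<and> \<not> g dvd h \<and> p = g * h)"

end

theory Submission
  imports Defs "HOL-Number_Theory.Residues" "HOL-Computational_Algebra.Computational_Algebra"
begin

text \<open>
  If \<open>f = z\<^sup>3 + 1/c\<close> is reducible, then \<open>c = m\<^sup>3\<close> for an integer \<open>m\<close> with \<open>\<bar>m\<bar> \<le> 10\<^sup>4\<close>. Put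
  \<open>r = 1/m\<close>. From \<open>f = z\<^sup>3 + r\<^sup>3 = (z + r) (z\<^sup>2 - r z + r\<^sup>2)\<close> it follows that the iterate
  \<open>F\<^sub>n\<^sub>+\<^sub>1 = f(F\<^sub>n)\<close> is the product of \<open>F\<^sub>n + r\<close> and \<open>F\<^sub>n\<^sup>2 - r F\<^sub>n + r\<^sup>2\<close>. These have different
  degrees, and the point is that they are irreducible.

  Irreducibility is proved by induction on \<open>n\<close>. If \<open>p\<close> is monic and irreducible and \<open>p(z\<^sup>3 + s)\<close>
  is reducible, then \<open>p(s)\<close> is a cube (\<open>irreducible_pcompose_cube_plus\<close>). Both factors at \<open>n + 1\<close>
  arise from the ones at \<open>n\<close> by composition with \<open>f\<close>, so it suffices that \<open>a\<^sub>n + r\<close> and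
  \<open>a\<^sub>n\<^sup>2 - a\<^sub>n r + r\<^sup>2\<close> are not cubes of rationals for \<open>n \<ge> 1\<close>, where \<open>a\<^sub>n\<close> is the orbit of \<open>0\<close>
  under \<open>f\<close>. Clearing denominators turns this into a statement about integers depending on \<open>m\<^sup>2\<close>
  (\<open>orbit_not_cube\<close>), which is proved differently according to the parity of \<open>n\<close>.

  For odd \<open>n\<close>, the number \<open>d\<close> obtained at \<open>n = 1\<close> (\<open>1 + m\<^sup>2\<close> or \<open>1 - m\<^sup>2 + m\<^sup>4\<close>) divides the
  number at \<open>n\<close>, with a cofactor coprime to \<open>d\<close> (\<open>odd_orbit_not_cube\<close>). So it suffices to exclude
  that \<open>d\<close> is a cube, which for each \<open>m\<close> is seen modulo a suitable prime.

  For even \<open>n\<close>, the orbit modulo a prime \<open>p\<close> is eventually periodic, so that one finite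
  computation can show for all \<open>n\<close> at once that the numbers are not cubes modulo \<open>p\<close>
  (\<open>even_orbit_not_cube\<close>). Whether it succeeds depends only on \<open>m\<close> modulo \<open>p\<close>, and this is where
  the bound on \<open>c\<close> enters: a table of residue classes modulo primes below \<open>1500\<close> is verified to
  cover every \<open>m\<close> up to \<open>10\<^sup>4\<close>.

  The case \<open>m = \<plusminus>1\<close> of the quadratic factor is exceptional, because the number at \<open>n = 1\<close> is the
  cube \<open>1\<close>. There the irreducibility of the corresponding factor is shown directly
  (\<open>irreducible_quadratic_factor_second_iterate\<close>), and the later values are not cubes modulo \<open>7\<close>.
\<close>

hide_const (open) up_ring.monom up_ring.coeff module.smult

section \<open>A norm criterion for irreducibility\<close>

text \<open>
  The polynomial \<open>h\<close> splits as \<open>h\<^sub>0(x\<^sup>3) + x h\<^sub>1(x\<^sup>3) + x\<^sup>2 h\<^sub>2(x\<^sup>3)\<close>, and \<open>trisect i h\<close> is \<open>h\<^sub>i\<close>.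
\<close>

definition trisect :: "nat \<Rightarrow> 'a::comm_ring_1 poly \<Rightarrow> 'a poly" where
  "trisect i h = Poly (map (\<lambda>k. coeff h (3 * k + i)) [0..<Suc (degree h)])"

text \<open>
  This is the norm of \<open>h\<close> from \<open>F[x]\<close> down to \<open>F[y]\<close> with \<open>y = x\<^sup>3\<close>. Over a field containing a
  primitive cube root of unity \<open>\<omega>\<close> it is the polynomial \<open>N\<close> with \<open>N(x\<^sup>3) = h(x) h(\<omega>x) h(\<omega>\<^sup>2x)\<close>;
  multiplying out gives \<open>a\<^sup>3 + b\<^sup>3 + c\<^sup>3 - 3abc\<close> for the three parts \<open>a\<close>, \<open>b\<close>, \<open>c\<close> of \<open>h\<close>, so \<open>\<omega>\<close>
  need not exist in \<open>F\<close>.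
\<close>

definition cubic_norm :: "'a::comm_ring_1 poly \<Rightarrow> 'a poly" where
  "cubic_norm h = trisect 0 h ^ 3 + [:0, 1:] * trisect 1 h ^ 3 + [:0, 1:]\<^sup>2 * trisect 2 h ^ 3
     - 3 * [:0, 1:] * trisect 0 h * trisect 1 h * trisect 2 h"

lemma coeff_trisect: "coeff (trisect i h) k = coeff h (3 * k + i)"
proof -
  have "coeff h (3 * k + i) = 0" if "k > degree h"
    using that by (intro coeff_eq_0) linarith
  then show ?thesis
    by (auto simp: trisect_def nth_default_def simp del: upt_Suc)
qed

lemma coeff_pcompose_cube:
  fixes p :: "'a::comm_ring_1 poly"
  shows "coeff (pcompose p (monom 1 3)) n = (if 3 dvd n then coeff p (n div 3) else 0)"
proof (induction p arbitrary: n)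
  case 0
  then show ?case by simp
next
  case (pCons a p)
  show ?case
  proof (cases "n < 3")
    case True
    then have "n = 0 \<or> n = 1 \<or> n = 2" by linarith
    moreover have "\<not> 3 dvd Suc (Suc 0)" by presburger
    ultimately show ?thesis
      by (auto simp: pcompose_pCons coeff_monom_mult coeff_pCons numeral_2_eq_2 split: nat.split)
  next
    case False
    then obtain k where k: "n = k + 3" by (metis add.commute le_add_diff_inverse not_less)
    then show ?thesis
      using pCons.IH[of k]
      by (auto simp: pcompose_pCons coeff_monom_mult coeff_pCons split: nat.split)
  qed
qed

lemma coeff_monom_mult_pcompose_cube:
  fixes p :: "'a::comm_ring_1 poly"
  assumes "i < 3"
  shows "coeff (monom 1 i * pcompose p (monom 1 3)) n = (if n mod 3 = i then coeff p (n div 3) else 0)"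
proof (cases "n < i")
  case True
  then show ?thesis using assms by (simp add: coeff_monom_mult)
next
  case False
  then have "3 dvd n - i \<longleftrightarrow> n mod 3 = i"
    using assms by (metis mod_eq_dvd_iff_nat mod_less not_less)
  moreover have "(n - i) div 3 = n div 3" if "n mod 3 = i"
    using that by (metis minus_mod_eq_mult_div nonzero_mult_div_cancel_left zero_neq_numeral)
  ultimately show ?thesis using False by (simp add: coeff_monom_mult coeff_pcompose_cube)
qed

lemma coeff_trisected:
  fixes a b c :: "'a::comm_ring_1 poly"
  shows "coeff (pcompose a (monom 1 3) + monom 1 1 * pcompose b (monom 1 3)
      + monom 1 2 * pcompose c (monom 1 3)) n =
    coeff (if n mod 3 = 0 then a else if n mod 3 = 1 then b else c) (n div 3)"
proof -
  have "n mod 3 = 0 \<or> n mod 3 = 1 \<or> n mod 3 = 2" by linarith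
  then show ?thesis
    using coeff_monom_mult_pcompose_cube[of 0 a n] coeff_monom_mult_pcompose_cube[of 1 b n]
      coeff_monom_mult_pcompose_cube[of 2 c n]
    by auto
qed

lemma trisect_decomposition:
  "h = pcompose (trisect 0 h) (monom 1 3) + monom 1 1 * pcompose (trisect 1 h) (monom 1 3)
     + monom 1 2 * pcompose (trisect 2 h) (monom 1 3)"
proof (rule poly_eqI)
  fix n :: nat
  define q where "q = n div 3"
  have "n = 3 * q \<or> n = 3 * q + 1 \<or> n = 3 * q + 2" unfolding q_def by linarith
  moreover have "(3 * q + 1) mod 3 = 1" "(3 * q + 1) div 3 = q" "(3 * q + 2) mod 3 = 2" "(3 * q + 2) div 3 = q"
    by presburger+
  ultimately show "coeff h n = coeff (pcompose (trisect 0 h) (monom 1 3)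
      + monom 1 1 * pcompose (trisect 1 h) (monom 1 3)
      + monom 1 2 * pcompose (trisect 2 h) (monom 1 3)) n"
    unfolding coeff_trisected by (auto simp: coeff_trisect)
qed

lemma trisect_unique:
  assumes "h = pcompose a (monom 1 3) + monom 1 1 * pcompose b (monom 1 3)
     + monom 1 2 * pcompose c (monom 1 3)"
  shows "trisect 0 h = a" "trisect 1 h = b" "trisect 2 h = c"
proof -
  have "(3 * k + 1) mod 3 = 1" "(3 * k + 1) div 3 = k" "(3 * k + 2) mod 3 = 2" "(3 * k + 2) div 3 = k"
    for k :: nat by presburger+
  then show "trisect 0 h = a" "trisect 1 h = b" "trisect 2 h = c"
    unfolding assms poly_eq_iff coeff_trisect coeff_trisected by simp_all
qed

text \<open>
  Writing both factors as combinations of \<open>1\<close>, \<open>x\<close>, \<open>x\<^sup>2\<close> over \<open>F[x\<^sup>3]\<close>, the parts of the product follow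
  from uniqueness of the decomposition, and the claim becomes a polynomial identity in six
  variables and \<open>y\<close>.
\<close>

lemma cubic_norm_mult: "cubic_norm (h * k) = cubic_norm h * cubic_norm k"
proof -
  define X Y :: "'a poly" where X: "X = [:0, 1:]" and Y: "Y = monom 1 1"
  define s :: "'a poly \<Rightarrow> 'a poly" where "s p = pcompose p (monom 1 3)" for p
  define a b c where abc: "a = trisect 0 h" "b = trisect 1 h" "c = trisect 2 h"
  define a' b' c' where abc': "a' = trisect 0 k" "b' = trisect 1 k" "c' = trisect 2 k"
  have s: "s (p + q) = s p + s q" "s (p * q) = s p * s q" "s X = Y ^ 3" "monom 1 2 = Y ^ 2" for p q
    by (simp_all add: s_def X Y pcompose_add pcompose_mult pcompose_pCons monom_power)
  have h: "h = s a + Y * s b + Y ^ 2 * s c" and k: "k = s a' + Y * s b' + Y ^ 2 * s c'"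
    unfolding abc abc' s(4)[symmetric] unfolding s_def Y by (rule trisect_decomposition)+
  have "h * k = s (a * a' + X * (b * c' + c * b')) + Y * s (a * b' + b * a' + X * (c * c'))
      + Y ^ 2 * s (a * c' + b * b' + c * a')"
    unfolding h k s by (simp add: algebra_simps power2_eq_square power3_eq_cube)
  note tri = trisect_unique[OF this[unfolded s(4)[symmetric], unfolded Y s_def]]
  show ?thesis
    unfolding cubic_norm_def tri X[symmetric] abc[symmetric] abc'[symmetric]
    by (simp add: algebra_simps power2_eq_square power3_eq_cube)
qed

lemma cubic_norm_pcompose_cube: "cubic_norm (pcompose q (monom 1 3)) = q ^ 3"
proof -
  have "pcompose q (monom 1 3) = pcompose q (monom 1 3) + monom 1 1 * pcompose 0 (monom 1 3)
     + monom 1 2 * pcompose 0 (monom 1 3)" by simp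
  from trisect_unique[OF this] show ?thesis by (simp add: cubic_norm_def)
qed

lemma coeff_cubic_norm_0: "coeff (cubic_norm h) 0 = coeff h 0 ^ 3"
  by (simp add: cubic_norm_def coeff_trisect coeff_mult_0 coeff_0_power power2_eq_square numeral_poly)

lemma coeff_mult_bounded:
  fixes p q :: "'a::comm_semiring_1 poly"
  assumes "degree p \<le> m" "degree q \<le> n"
  shows "coeff (p * q) (m + n) = coeff p m * coeff q n"
proof (cases "degree p = m \<and> degree q = n")
  case True
  then show ?thesis using coeff_mult_degree_sum by blast
next
  case False
  then have "degree (p * q) < m + n"
    using degree_mult_le[of p q] assms by linarith
  then show ?thesis using False assms
    by (metis coeff_eq_0 le_neq_implies_less mult_zero_left mult_zero_right)
qed

text \<open>
  In \<open>a\<^sup>3 + b\<^sup>3 + c\<^sup>3 - 3abc\<close>, with all three parts of degree at most \<open>D = degree h\<close>, exactly one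
  of the parts has a nonzero coefficient at \<open>D\<close>, namely the one singled out by \<open>D mod 3\<close>. So the
  coefficient at \<open>3D\<close> is the cube of the leading coefficient of \<open>h\<close>.
\<close>

lemma cubic_norm_degree_lead:
  fixes h :: "'a::idom poly"
  assumes "h \<noteq> 0"
  shows "degree (cubic_norm h) = degree h" "lead_coeff (cubic_norm h) = lead_coeff h ^ 3"
proof -
  define X Y :: "'a poly" where X: "X = [:0, 1:]" and Y: "Y = monom 1 1"
  define s :: "'a poly \<Rightarrow> 'a poly" where "s p = pcompose p (monom 1 3)" for p
  define a b c where abc: "a = s (trisect 0 h)" "b = Y * s (trisect 1 h)"
    "c = Y ^ 2 * s (trisect 2 h)"
  define D where "D = degree h"
  have s: "s (p + q) = s p + s q" "s (p - q) = s p - s q" "s (p * q) = s p * s q" "s (p ^ 2) = s p ^ 2"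
      "s (p ^ 3) = s p ^ 3" "s X = Y ^ 3" "s 3 = 3" "monom 1 2 = Y ^ 2" for p q
    by (simp_all add: s_def X Y pcompose_add pcompose_diff pcompose_mult pcompose_pCons
        power2_eq_square power3_eq_cube mult_monom numeral_poly eval_nat_numeral)
  have norm: "s (cubic_norm h) = a * a * a + b * b * b + c * c * c - smult 3 (a * b * c)"
  proof -
    have "s (cubic_norm h) = a * a * a + b * b * b + c * c * c - 3 * (a * b * c)"
      unfolding cubic_norm_def X[symmetric] s abc
        by (simp add: algebra_simps power2_eq_square power3_eq_cube)
    then show ?thesis by (simp add: numeral_poly)
  qed
  have *: "n mod 3 = 0 \<Longrightarrow> 3 * (n div 3) = n" "n mod 3 = 1 \<Longrightarrow> 3 * (n div 3) + 1 = n"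
      "n mod 3 = 2 \<Longrightarrow> 3 * (n div 3) + 2 = n" for n :: nat
    by presburger+
  have co: "coeff a n = (if n mod 3 = 0 then coeff h n else 0)"
       "coeff b n = (if n mod 3 = 1 then coeff h n else 0)"
       "coeff c n = (if n mod 3 = 2 then coeff h n else 0)" for n
    using coeff_monom_mult_pcompose_cube[of 0 "trisect 0 h" n]
      coeff_monom_mult_pcompose_cube[of 1 "trisect 1 h" n]
      coeff_monom_mult_pcompose_cube[of 2 "trisect 2 h" n]
      *[of n]
    unfolding abc s(8)[symmetric] unfolding Y s_def by (auto simp: coeff_trisect)
  have deg: "degree a \<le> D" "degree b \<le> D" "degree c \<le> D"
    unfolding D_def by (auto intro!: degree_le simp: co coeff_eq_0)
  have deg2: "degree (p * q) \<le> D + D" and deg3: "degree (p * q * r) \<le> D + D + D"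
    and top: "coeff (p * q * r) (D + D + D) = coeff p D * coeff q D * coeff r D"
    if "degree p \<le> D" "degree q \<le> D" "degree r \<le> D" for p q r :: "'a poly"
  proof -
    show 1: "degree (p * q) \<le> D + D" using degree_mult_le[of p q] that by linarith
    show "degree (p * q * r) \<le> D + D + D"
      using degree_mult_le[of "p * q" r] 1 that by linarith
    show "coeff (p * q * r) (D + D + D) = coeff p D * coeff q D * coeff r D"
      using coeff_mult_bounded[OF 1 that(3)] coeff_mult_bounded[OF that(1,2)] by simp
  qed
  have "degree (s (cubic_norm h)) \<le> D + D + D"
    unfolding norm
    by (intro degree_diff_le degree_add_le order.trans[OF degree_smult_le] deg3 deg)
  then have le: "degree (cubic_norm h) \<le> D"
    by (simp add: s_def degree_pcompose degree_monom_eq)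
  have D_mod: "D mod 3 = 0 \<or> D mod 3 = 1 \<or> D mod 3 = 2" by linarith
  have three_D: "D + D + D = 3 * D" by linarith
  have "coeff (cubic_norm h) D = coeff (s (cubic_norm h)) (D + D + D)"
    unfolding three_D s_def coeff_pcompose_cube by simp
  also have "\<dots> = coeff h D ^ 3"
    unfolding norm coeff_diff coeff_add coeff_smult top[OF deg(1,1,1)] top[OF deg(2,2,2)] top[OF deg(3,3,3)] top[OF deg]
    using D_mod by (elim disjE) (simp_all add: co power3_eq_cube D_def[symmetric])
  finally have lead: "coeff (cubic_norm h) D = lead_coeff h ^ 3" unfolding D_def .
  with assms have "coeff (cubic_norm h) D \<noteq> 0" by simp
  with le show deg_eq: "degree (cubic_norm h) = degree h"
    using le_degree[of "cubic_norm h" D] D_def by simp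
  with lead show "lead_coeff (cubic_norm h) = lead_coeff h ^ 3"
    by (simp add: D_def)
qed

text \<open>
  If \<open>q(x\<^sup>3) = h k\<close>, then \<open>q\<^sup>3 = N(h) N(k)\<close>. As \<open>q\<close> is prime, \<open>q\<^sup>2\<close> divides one of the two norms,
  which leaves the other norm a divisor of \<open>q\<close>. It has positive degree, so it is \<open>q\<close> up to a
  constant factor, and the constant is read off from the leading coefficients.
\<close>

lemma reducible_pcompose_cube:
  fixes q :: "'a::field poly"
  assumes irr: "irreducible q" and red: "\<not> irreducible (pcompose q (monom 1 3))"
  obtains h where "h \<noteq> 0" "degree h = degree q"
    "smult (lead_coeff q) (cubic_norm h) = smult (lead_coeff h ^ 3) q"
proof -
  note result = that
  let ?Q = "pcompose q (monom 1 3)"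
  have q0: "q \<noteq> 0" and prime: "prime_elem q"
    using irr by (auto simp: field_poly_irreducible_imp_prime)
  have dq: "degree q > 0" 
    using irr by (meson gr0I irreducible_not_unit is_unit_iff_degree q0)
  have dQ: "degree ?Q = 3 * degree q" by (simp add: degree_pcompose degree_monom_eq)
  moreover from this dq have "?Q \<noteq> 0" by auto
  ultimately have "?Q \<noteq> 0" "\<not> ?Q dvd 1" using dq by (auto simp: is_unit_iff_degree)
  then obtain h k where hk: "?Q = h * k" "\<not> h dvd 1" "\<not> k dvd 1"
    using red unfolding irreducible_def by blast
  have main: thesis if hk: "q ^ 3 = cubic_norm h * cubic_norm k" "h \<noteq> 0" "k \<noteq> 0"
       "degree k > 0" and dvd: "q ^ 2 dvd cubic_norm h" for h k
  proof -
    from dvd obtain r where r: "cubic_norm h = q ^ 2 * r" by (elim dvdE)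
    then have "q ^ 2 * q = q ^ 2 * (r * cubic_norm k)"
      using hk(1) by (simp add: power2_eq_square power3_eq_cube mult.assoc)
    then have eq: "q = r * cubic_norm k" using q0 by simp
    \<comment> \<open>The norm of \<open>k\<close> is not constant, so by irreducibility of \<open>q\<close> the other factor is.\<close>
    moreover have "\<not> cubic_norm k dvd 1"
      using cubic_norm_degree_lead(1)[OF \<open>k \<noteq> 0\<close>] hk(4)
      by (metis is_unit_iff_degree not_is_unit_0 less_irrefl)
    ultimately have "r dvd 1" using irr unfolding irreducible_def by blast
    then obtain u where u: "r = [:u:]" "u \<noteq> 0" by (metis is_unit_poly_iff dvd_0_left_iff zero_neq_one)
    have eq': "q = smult u (cubic_norm k)" using eq u by simp
    have l: "lead_coeff q = u * lead_coeff k ^ 3"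
      unfolding eq' using cubic_norm_degree_lead[OF \<open>k \<noteq> 0\<close>] u by (simp add: lead_coeff_smult)
    show thesis
    proof (rule result[OF \<open>k \<noteq> 0\<close>])
      show "degree k = degree q"
        unfolding eq' using cubic_norm_degree_lead(1)[OF \<open>k \<noteq> 0\<close>] u by simp
      show "smult (lead_coeff q) (cubic_norm k) = smult (lead_coeff k ^ 3) q"
        unfolding l by (subst eq') (simp add: mult.commute)
    qed
  qed
  have n: "q ^ 3 = cubic_norm h * cubic_norm k" "q ^ 3 = cubic_norm k * cubic_norm h"
    by (simp_all add: hk(1)[symmetric] cubic_norm_mult[symmetric] cubic_norm_pcompose_cube mult.commute)
  have nz: "h \<noteq> 0" "k \<noteq> 0" using hk \<open>?Q \<noteq> 0\<close> by auto
  have "degree h > 0" "degree k > 0" using hk nz by (auto simp: is_unit_iff_degree)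
  moreover have "q ^ 2 dvd cubic_norm h \<or> q ^ 2 dvd cubic_norm k"
    by (rule prime_elem_power_dvd_cases[OF _ _ prime, of 3]) (simp_all add: n)
  ultimately show thesis using main n nz by blast
qed

lemma irreducible_pcompose_linear_iff:
  fixes p :: "'a::field poly"
  shows "irreducible (pcompose p [:s, 1:]) \<longleftrightarrow> irreducible p"
proof -
  have one: "irreducible (pcompose p [:s, 1:])" if "irreducible p" for p :: "'a poly" and s
  proof (rule irreducibleI)
    have unit: "pcompose q [:t, 1:] dvd 1 \<longleftrightarrow> q dvd 1" for q :: "'a poly" and t
      by (cases "q = 0") (auto simp: is_unit_iff_degree degree_pcompose pcompose_eq_0_iff)
    show "pcompose p [:s, 1:] \<noteq> 0" using that by (auto simp: pcompose_eq_0_iff)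
    show "\<not> pcompose p [:s, 1:] dvd 1"
      using that by (simp add: unit irreducible_not_unit)
    fix a b assume ab: "pcompose p [:s, 1:] = a * b"
    have "pcompose (pcompose p [:s, 1:]) [:- s, 1:] = p"
      by (simp add: pcompose_assoc[symmetric] pcompose_pCons)
    then have "p = pcompose a [:- s, 1:] * pcompose b [:- s, 1:]"
      by (simp add: ab pcompose_mult)
    then show "a dvd 1 \<or> b dvd 1"
      using that unit by (metis irreducibleD)
  qed
  have "pcompose (pcompose p [:s, 1:]) [:- s, 1:] = p"
    by (simp add: pcompose_assoc[symmetric] pcompose_pCons)
  with one show ?thesis by metis
qed

lemma reducible_pcompose_cube_plus:
  fixes p :: "'a::field poly"
  assumes irr: "irreducible p" and red: "\<not> irreducible (pcompose p (monom 1 3 + [:s:]))"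
  obtains h where "h \<noteq> 0" "degree h = degree p"
    "smult (lead_coeff p) (cubic_norm h) = smult (lead_coeff h ^ 3) (pcompose p [:s, 1:])"
proof -
  let ?q = "pcompose p [:s, 1:]"
  have "pcompose [:s, 1:] (monom 1 3) = monom 1 3 + [:s:]"
    by (simp add: pcompose_pCons)
  then have "pcompose ?q (monom 1 3) = pcompose p (monom 1 3 + [:s:])"
    by (simp add: pcompose_assoc[symmetric])
  with red have red': "\<not> irreducible (pcompose ?q (monom 1 3))" by simp
  have irr': "irreducible ?q" using irr by (simp add: irreducible_pcompose_linear_iff)
  have "degree ?q = degree p" by (simp add: degree_pcompose)
  moreover have "lead_coeff ?q = lead_coeff p" by (simp add: lead_coeff_comp)
  ultimately show thesis using reducible_pcompose_cube[OF irr' red'] that by metis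
qed

text \<open>
  The constant term of \<open>N(h)\<close> is \<open>h(0)\<^sup>3\<close>, so the preceding lemma makes \<open>p(s)\<close> a cube. This
  replaces the usual argument that takes the norm of \<open>s - \<alpha>\<close> from the field generated by a root \<open>\<alpha>\<close> of
  \<open>p\<close>.
\<close>

lemma irreducible_pcompose_cube_plus:
  fixes p :: "'a::field poly"
  assumes irr: "irreducible p" and monic: "lead_coeff p = 1"
    and noncube: "\<And>y. poly p s \<noteq> y ^ 3"
  shows "irreducible (pcompose p (monom 1 3 + [:s:]))"
proof (rule ccontr)
  assume "\<not> irreducible (pcompose p (monom 1 3 + [:s:]))"
  then obtain h where h: "h \<noteq> 0"
    and eq: "smult (lead_coeff p) (cubic_norm h) = smult (lead_coeff h ^ 3) (pcompose p [:s, 1:])"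
    by (rule reducible_pcompose_cube_plus[OF irr])
  have "coeff h 0 ^ 3 = lead_coeff h ^ 3 * poly p s"
    using arg_cong[OF eq, of "\<lambda>r. coeff r 0"] monic 
    by (simp add: coeff_cubic_norm_0)
  then have "poly p s = (coeff h 0 / lead_coeff h) ^ 3"
    using h by (simp add: power_divide field_simps)
  with noncube show False by blast
qed

section \<open>The critical orbit over the integers\<close>

text \<open>
  With \<open>r = 1/m\<close>, the orbit of \<open>0\<close> under \<open>z\<^sup>3 + r\<^sup>3\<close> consists of the fractions \<open>A\<^sub>n / m^(3^n)\<close> for
  integers \<open>A\<^sub>n\<close>. The exponent \<open>3^n\<close> is never \<open>0\<close>, so that \<open>m^(3^n) = m B\<^sub>n\<close> and
  \<open>r = B\<^sub>n / m^(3^n)\<close>. The recursions below are those of \<open>B\<^sub>n\<close> and \<open>A\<^sub>n\<close>; only even powers of \<open>m\<close>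
  occur in them.
\<close>

primrec orbit_cofactor :: "int \<Rightarrow> nat \<Rightarrow> int" where
  "orbit_cofactor m 0 = 1"
| "orbit_cofactor m (Suc n) = m\<^sup>2 * orbit_cofactor m n ^ 3"

primrec orbit_num :: "int \<Rightarrow> nat \<Rightarrow> int" where
  "orbit_num m 0 = 0"
| "orbit_num m (Suc n) = orbit_num m n ^ 3 + orbit_cofactor m n ^ 3"

text \<open>
  The two factors of \<open>a\<^sup>3 + b\<^sup>3\<close>. The Boolean selects the factor, because both are treated alike
  everywhere below.
\<close>

definition factor_form :: "bool \<Rightarrow> 'a::comm_ring_1 \<Rightarrow> 'a \<Rightarrow> 'a" where
  "factor_form quadratic a b = (if quadratic then a\<^sup>2 - a * b + b\<^sup>2 else a + b)"

lemma factor_form_mult: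
  "factor_form q (t * a) (t * b) = t ^ (if q then 2 else 1) * factor_form q a b"
  by (simp add: factor_form_def algebra_simps power2_eq_square)

lemma factor_form_cong:
  fixes a b :: int
  assumes "[a = a'] (mod p)" "[b = b'] (mod p)"
  shows "[factor_form q a b = factor_form q a' b'] (mod p)"
  using assms by (auto simp: factor_form_def intro!: cong_add cong_diff cong_mult cong_pow)

lemma factor_form_mult_forms: "factor_form False a b * factor_form True a b = a ^ 3 + b ^ 3"
  by (simp add: factor_form_def algebra_simps power2_eq_square power3_eq_cube)

lemma times_orbit_cofactor: "m * orbit_cofactor m n = m ^ (3 ^ n)"
proof (induction n)
  case (Suc n)
  have "m * orbit_cofactor m (Suc n) = (m * orbit_cofactor m n) ^ 3"
    by (simp add: power_mult_distrib power2_eq_square power3_eq_cube)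
  then show ?case by (simp add: Suc power_mult[symmetric] mult.commute)
qed simp

section \<open>Odd iterates\<close>

text \<open>
  Modulo \<open>c = factor_form q 1 (m\<^sup>2)\<close>, which is the chosen factor of \<open>A\<^sub>1\<^sup>3 + B\<^sub>1\<^sup>3 = A\<^sub>2\<close>, the
  orbit of \<open>0\<close> has period two: if \<open>A\<^sub>k\<close> is \<open>0\<close> modulo \<open>c\<close>, then \<open>(A\<^sub>k\<^sub>+\<^sub>1, B\<^sub>k\<^sub>+\<^sub>1)\<close> is
  proportional to \<open>(1, m\<^sup>2)\<close>, so \<open>c\<close> divides the form there and hence \<open>A\<^sub>k\<^sub>+\<^sub>2\<close>.
\<close>

lemma orbit_num_even_dvd:
  assumes "even n"
  shows "factor_form q 1 (m\<^sup>2) dvd orbit_num m n"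
  using assms
proof (induction n rule: less_induct)
  case (less n)
  show ?case
  proof (cases "n = 0")
    case False
    from less.prems obtain j where "n = 2 * j" by (elim evenE)
    then obtain k where k: "n = Suc (Suc k)" "even k"
      using False by (cases j) auto
    define x where "x = orbit_cofactor m k"
    have dvd: "factor_form q 1 (m\<^sup>2) dvd orbit_num m k" using less.IH[of k] k by simp
    have "[factor_form q (orbit_num m (Suc k)) (orbit_cofactor m (Suc k))
        = factor_form q (0 ^ 3 + x ^ 3) (m\<^sup>2 * x ^ 3)] (mod factor_form q 1 (m\<^sup>2))"
      unfolding orbit_num.simps orbit_cofactor.simps x_def[symmetric]
      using dvd by (intro factor_form_cong cong_add cong_pow cong_refl) (simp add: cong_0_iff)
    also have "factor_form q (0 ^ 3 + x ^ 3) (m\<^sup>2 * x ^ 3) = factor_form q (x ^ 3 * 1) (x ^ 3 * m\<^sup>2)"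
      by (simp add: mult.commute)
    also have "[\<dots> = 0] (mod factor_form q 1 (m\<^sup>2))"
      unfolding factor_form_mult by (simp add: cong_0_iff)
    finally have "factor_form q 1 (m\<^sup>2) dvd factor_form q (orbit_num m (Suc k)) (orbit_cofactor m (Suc k))"
      by (simp add: cong_0_iff)
    then have "factor_form q 1 (m\<^sup>2) dvd orbit_num m (Suc k) ^ 3 + orbit_cofactor m (Suc k) ^ 3"
      unfolding factor_form_mult_forms[symmetric] by (cases q) auto
    then show ?thesis by (simp add: k(1))
  qed simp
qed

lemma cube_of_coprime_mult:
  fixes a b y :: int
  assumes "coprime a b" "a * b = y ^ 3" "a > 0"
  shows "\<exists>z. a = z ^ 3"
proof (cases "b = 0")
  case True
  with assms have "a = 1 ^ 3" by simp
  then show ?thesis by blast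
next
  case False
  have "is_nth_power 3 (nat \<bar>a\<bar> * nat \<bar>b\<bar>)"
  proof (rule is_nth_powerI)
    show "nat \<bar>a\<bar> * nat \<bar>b\<bar> = nat \<bar>y\<bar> ^ 3"
      using assms(2) by (metis abs_ge_zero abs_mult nat_mult_distrib nat_power_eq power_abs)
  qed
  moreover have "coprime (nat \<bar>a\<bar>) (nat \<bar>b\<bar>)" using assms(1) by simp
  ultimately have "is_nth_power 3 (nat \<bar>a\<bar>)"
    using assms(3) False by (intro is_nth_power_mult_coprime_natD(1)[of "nat \<bar>a\<bar>" "nat \<bar>b\<bar>"]) simp_all
  then obtain z where "nat \<bar>a\<bar> = z ^ 3" by (rule is_nth_powerE)
  then have "a = int z ^ 3" using assms(3) by (metis abs_of_pos int_nat_eq of_nat_power order_less_le)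
  then show ?thesis by blast
qed

lemma factor_form_pos: "factor_form q 1 (m\<^sup>2) > (0::int)"
proof (cases q)
  case True
  have "0 < 3 + (2 * m\<^sup>2 - 1)\<^sup>2" by (smt (verit) zero_le_power2)
  also have "\<dots> = 4 * (1 - m\<^sup>2 + (m\<^sup>2)\<^sup>2)" by (simp add: algebra_simps power2_eq_square)
  finally show ?thesis using True by (simp add: factor_form_def)
qed (simp add: factor_form_def add_pos_nonneg)

lemma coprime_factor_form: "coprime (factor_form q 1 (m\<^sup>2)) (m::int)"
proof (rule coprimeI)
  fix d assume "d dvd factor_form q 1 (m\<^sup>2)" "d dvd m"
  moreover have "factor_form q 1 (m\<^sup>2) = 1 + m * (if q then m ^ 3 - m else m)"
    by (simp add: factor_form_def power2_eq_square power3_eq_cube algebra_simps)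
  ultimately show "is_unit d" by (metis dvd_add_left_iff dvd_mult2)
qed

text \<open>
  The sequence is a rigid divisibility sequence. For odd \<open>n\<close> the number
  \<open>c = factor_form q 1 (m\<^sup>2)\<close> divides \<open>A\<^sub>n\<^sub>-\<^sub>1\<close>, which enters the value at \<open>n\<close> only through its
  cube. So modulo \<open>c\<^sup>2\<close> that value is \<open>c\<close> times a power of \<open>B\<^sub>n\<^sub>-\<^sub>1\<close>, that is, \<open>c u\<close> with \<open>u\<close>
  coprime to \<open>c\<close>, and it can be a cube only if \<open>c\<close> itself is one.
\<close>

lemma odd_orbit_not_cube:
  assumes "odd n" and noncube: "\<And>y. factor_form q 1 (m\<^sup>2) \<noteq> y ^ 3"
  shows "factor_form q (orbit_num m n) (orbit_cofactor m n) \<noteq> y ^ 3"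
proof
  assume y: "factor_form q (orbit_num m n) (orbit_cofactor m n) = y ^ 3"
  define c where "c = factor_form q 1 (m\<^sup>2)"
  from \<open>odd n\<close> obtain k where k: "n = Suc k" "even k" by (metis even_Suc odd_pos gr0_conv_Suc)
  define x where "x = orbit_cofactor m k"
  have "c dvd orbit_num m k" unfolding c_def using k(2) by (rule orbit_num_even_dvd)
  then obtain b where b: "orbit_num m k = c * b" by (elim dvdE)
  have "c * c dvd factor_form q (orbit_num m n) (orbit_cofactor m n) - (x ^ 3) ^ (if q then 2 else 1) * c"
  proof -
    have "c * c dvd (orbit_num m k) ^ 3"
      by (simp add: b power_mult_distrib power3_eq_cube mult.assoc)
    then have "[orbit_num m n = x ^ 3 * 1] (mod (c * c))"
      by (simp add: k(1) x_def cong_iff_dvd_diff)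
    moreover have "orbit_cofactor m n = x ^ 3 * m\<^sup>2" by (simp add: k(1) x_def)
    ultimately have "[factor_form q (orbit_num m n) (orbit_cofactor m n)
        = factor_form q (x ^ 3 * 1) (x ^ 3 * m\<^sup>2)] (mod (c * c))"
      by (intro factor_form_cong) simp_all
    then show ?thesis unfolding factor_form_mult c_def by (simp add: cong_iff_dvd_diff)
  qed
  then obtain d where d: "y ^ 3 - (x ^ 3) ^ (if q then 2 else 1) * c = c * c * d" unfolding y by (elim dvdE)
  define u where "u = (x ^ 3) ^ (if q then 2 else 1) + c * d"
  have "c * u = y ^ 3" using d by (simp add: u_def algebra_simps)
  moreover have "coprime c u"
  proof -
    have "coprime c (m * x)"
      unfolding x_def times_orbit_cofactor c_def using coprime_factor_form by simp
    then have "coprime c ((x ^ 3) ^ (if q then 2 else 1))" by auto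
    then show ?thesis unfolding u_def by (metis add.commute coprime_iff_gcd_eq_1 gcd_add_mult mult.commute)
  qed
  moreover have "c > 0" unfolding c_def by (rule factor_form_pos)
  ultimately obtain z where "c = z ^ 3" using cube_of_coprime_mult by blast
  with noncube show False unfolding c_def by blast
qed

section \<open>Cubes modulo primes\<close>

text \<open>
  Only primes congruent to \<open>1\<close> modulo \<open>3\<close> have residues that are not cubes; these are recognised
  by their \<open>(p - 1)/3\<close>-th power, by Fermat's little theorem. The factor \<open>t\<^sup>3\<close> takes care of the
  denominators.
\<close>

lemma not_cube_of_residue:
  fixes v w t y :: int
  assumes p: "prime p" "p = 3 * int e + 1" and w: "[w = t ^ 3 * v] (mod p)" "\<not> p dvd t"
    and res: "v ^ e mod p \<noteq> 0" "v ^ e mod p \<noteq> 1"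
  shows "w \<noteq> y ^ 3"
proof
  assume y: "w = y ^ 3"
  have p1: "p > 1" using p(1) prime_gt_1_int by blast
  have fermat: "[z ^ (3 * e) = 1] (mod p)" if "\<not> p dvd z" for z
  proof -
    define z' where "z' = nat (z mod p)"
    have z': "int z' = z mod p" using p1 by (simp add: z'_def)
    have np: "int (nat p) = p" using p1 by simp
    have "\<not> nat p dvd z'"
    proof
      assume "nat p dvd z'"
      then have "p dvd z mod p" using np z' by (metis int_dvd_int_iff)
      with that show False by (simp add: dvd_mod_iff)
    qed
    moreover have "prime (nat p)" using p(1) prime_int_nat_transfer by blast
    ultimately have "[z' ^ (nat p - 1) = 1] (mod nat p)" using fermat_theorem by blast
    then have "[int (z' ^ (nat p - 1)) = int 1] (mod int (nat p))" by (simp only: cong_int_iff)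
    moreover have "nat p - 1 = 3 * e" using p(2) by simp
    ultimately have "[(z mod p) ^ (3 * e) = 1] (mod p)" using z' np by simp
    then show ?thesis by (simp add: cong_def power_mod)
  qed
  have "[y ^ (3 * e) = (t ^ 3 * v) ^ e] (mod p)"
    using cong_pow[OF w(1), of e] y by (simp add: power_mult)
  also have "(t ^ 3 * v) ^ e = t ^ (3 * e) * v ^ e" by (simp add: power_mult_distrib power_mult)
  also have "[\<dots> = 1 * v ^ e] (mod p)" using fermat[OF w(2)] by (rule cong_scalar_right)
  finally have *: "[y ^ (3 * e) = v ^ e] (mod p)" by simp
  show False
  proof (cases "p dvd y")
    case True
    have "e > 0" using p p1 by (cases e) auto
    then have "p dvd y ^ (3 * e)" using True by (simp add: dvd_power_le dvd_trans dvd_power)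
    then show False using * res(1) by (metis cong_def dvd_imp_mod_0)
  next
    case False
    then show False using fermat[OF False] * res(2) p1 by (simp add: cong_def)
  qed
qed

definition pow_mod :: "int \<Rightarrow> int \<Rightarrow> int \<Rightarrow> int" where
  "pow_mod p x e = x ^ nat e mod p"

text \<open>
  Repeated squaring along the binary digits of the exponent. The residue checks below are
  evaluated by rewriting, and for that the exponents are kept in binary.
\<close>

lemma pow_mod_code [code]:
  "pow_mod p x 0 = 1 mod p"
  "pow_mod p x (Int.Pos num.One) = x mod p"
  "pow_mod p x (Int.Pos (num.Bit0 n)) = (let y = pow_mod p x (Int.Pos n) in y * y mod p)"
  "pow_mod p x (Int.Pos (num.Bit1 n)) = (let y = pow_mod p x (Int.Pos n) in (y * y mod p) * x mod p)"
  "pow_mod p x (Int.Neg n) = 1 mod p"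
proof -
  define z where "z = x ^ numeral n"
  have z: "x ^ numeral (num.Bit0 n) = z * z" "x ^ numeral (num.Bit1 n) = z * z * x"
    unfolding power_numeral_even power_numeral_odd Let_def z_def by (simp_all only: mult_ac)
  have sq: "(z mod p) * (z mod p) mod p = z * z mod p" by (simp only: mod_mult_eq)
  show "pow_mod p x (Int.Pos (num.Bit0 n)) = (let y = pow_mod p x (Int.Pos n) in y * y mod p)"
    by (simp only: pow_mod_def Let_def Int.Pos_def nat_numeral z z_def[symmetric] sq)
  show "pow_mod p x (Int.Pos (num.Bit1 n)) = (let y = pow_mod p x (Int.Pos n) in (y * y mod p) * x mod p)"
    by (simp only: pow_mod_def Let_def Int.Pos_def nat_numeral z z_def[symmetric] sq,
        simp only: mod_mult_left_eq)
qed (simp_all add: pow_mod_def)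

text \<open>
  In the functions below that are evaluated, conjunctions and disjunctions are written as
  conditionals: rewriting normalises both arguments of a conjunction, but only the branch of a
  conditional that is taken.
\<close>

definition noncube_residue :: "int \<Rightarrow> int \<Rightarrow> bool" where
  "noncube_residue p v \<longleftrightarrow> (let u = pow_mod p v ((p - 1) div 3) in if u = 0 then False else u \<noteq> 1)"

fun mem :: "int \<Rightarrow> int list \<Rightarrow> bool" where
  "mem x [] = False"
| "mem x (y # ys) = (if x = y then True else mem x ys)"

lemma mem_iff: "mem x ys \<longleftrightarrow> x \<in> set ys"
  by (induction ys) auto

definition orbit_step :: "int \<Rightarrow> int \<Rightarrow> int \<Rightarrow> int" where
  "orbit_step p s a = (a * a mod p * a + s) mod p"

text \<open>
  Follows the orbit of \<open>a\<close> under two steps of \<open>z \<mapsto> z\<^sup>3 + s\<close> modulo \<open>p\<close> until it runs into a point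
  seen before, testing the form at every new point. Some residue makes the form vanish and so
  fails the test; hence fewer than \<open>p\<close> points are collected, and \<open>p\<close> is enough fuel.
\<close>

function orbit_avoids_cubes :: "bool \<Rightarrow> int \<Rightarrow> int \<Rightarrow> int \<Rightarrow> int \<Rightarrow> int list \<Rightarrow> int \<Rightarrow> bool" where
  "orbit_avoids_cubes q p r s fuel seen a =
    (if fuel \<le> 0 then False
     else if mem a seen then True
     else if noncube_residue p (if q then a * a + (r - a) * r else a + r)
     then orbit_avoids_cubes q p r s (fuel - 1) (a # seen) (orbit_step p s (orbit_step p s a))
     else False)"
  by pat_completeness auto
termination by (relation "measure (\<lambda>(q, p, r, s, fuel, seen, a). nat fuel)") auto
declare orbit_avoids_cubes.simps [simp del]

text \<open>
  When the search stops at a point already seen, the points seen are closed under two steps.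
\<close>

lemma orbit_avoids_cubes_invariant_set:
  assumes "orbit_avoids_cubes q p r s fuel seen a"
    and "\<forall>x\<in>set seen. noncube_residue p (factor_form q x r)
       \<and> orbit_step p s (orbit_step p s x) \<in> insert a (set seen)"
  shows "\<exists>S. insert a (set seen) \<subseteq> S \<and>
    (\<forall>x\<in>S. noncube_residue p (factor_form q x r) \<and> orbit_step p s (orbit_step p s x) \<in> S)"
  using assms
proof (induction q p r s fuel seen a rule: orbit_avoids_cubes.induct)
  case (1 q p r s fuel seen a)
  have form: "(if q then a * a + (r - a) * r else a + r) = factor_form q a r"
    by (simp add: factor_form_def algebra_simps power2_eq_square)
  show ?case
  proof (cases "mem a seen")
    case True
    then show ?thesis using "1.prems"(2) by (intro exI[of _ "set seen"]) (auto simp: mem_iff insert_absorb)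
  next
    case False
    have fuel: "\<not> fuel \<le> 0" and good: "noncube_residue p (factor_form q a r)"
      and rec: "orbit_avoids_cubes q p r s (fuel - 1) (a # seen) (orbit_step p s (orbit_step p s a))"
      using "1.prems"(1) False unfolding orbit_avoids_cubes.simps[of q p r s fuel seen a] form
      by (auto split: if_splits)
    have "\<exists>S. insert (orbit_step p s (orbit_step p s a)) (set (a # seen)) \<subseteq> S \<and>
       (\<forall>x\<in>S. noncube_residue p (factor_form q x r) \<and> orbit_step p s (orbit_step p s x) \<in> S)"
      using "1.IH"[unfolded form, OF fuel False good rec] good "1.prems"(2) by auto
    then show ?thesis by (metis insert_subset list.simps(15))
  qed
qed

definition residue_works :: "bool \<Rightarrow> int \<Rightarrow> int \<Rightarrow> bool" where
  "residue_works q p x = (let r = pow_mod p x (p - 2) in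
     if x * r mod p = 1 then
       let s = r * r mod p * r mod p in orbit_avoids_cubes q p r s p [] (orbit_step p s (orbit_step p s 0))
     else False)"

text \<open>
  If \<open>r\<close> is inverse to \<open>m\<close> modulo \<open>p\<close>, then \<open>(A\<^sub>n, B\<^sub>n)\<close> is congruent to \<open>m^(3^n)\<close> times
  \<open>(a\<^sub>n, r)\<close>, where \<open>a\<^sub>n\<close> is the orbit of \<open>0\<close> modulo \<open>p\<close>. For \<open>n > 0\<close> the power \<open>m^(3^n)\<close> is a
  cube, so it does not matter for being a cube modulo \<open>p\<close>. As the orbit modulo \<open>p\<close> is eventually
  periodic, one finite check settles all even \<open>n > 0\<close>.
\<close>

lemma even_orbit_not_cube:
  assumes "residue_works q p (m mod p)" "prime p" "p mod 3 = 1" "even n" "n > 0"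
  shows "factor_form q (orbit_num m n) (orbit_cofactor m n) \<noteq> y ^ 3"
proof -
  define x where "x = m mod p"
  define r where "r = pow_mod p x (p - 2)"
  define s where "s = r * r mod p * r mod p"
  have inv: "x * r mod p = 1" and
    avoid: "orbit_avoids_cubes q p r s p [] (orbit_step p s (orbit_step p s 0))"
    using assms(1) by (auto simp: residue_works_def x_def r_def s_def Let_def split: if_splits)
  have mr: "[m * r = 1] (mod p)"
    using inv unfolding x_def cong_def by (metis mod_mod_trivial mod_mult_left_eq)
  define T where "T k = m ^ (3 ^ k)" for k :: nat
  define a where "a k = (orbit_step p s ^^ k) 0" for k
  have s: "[s = r ^ 3] (mod p)"
    by (simp add: s_def cong_def power3_eq_cube mod_simps)
  have cof: "[orbit_cofactor m k = T k * r] (mod p)" for k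
  proof -
    have "T k * r = orbit_cofactor m k * (m * r)"
      unfolding T_def times_orbit_cofactor[symmetric] by simp
    also have "[\<dots> = orbit_cofactor m k * 1] (mod p)" by (rule cong_scalar_left[OF mr])
    finally show ?thesis by (simp add: cong_sym_eq)
  qed
  have num: "[orbit_num m k = T k * a k] (mod p)" for k
  proof (induction k)
    case (Suc k)
    have "[orbit_num m (Suc k) = (T k * a k) ^ 3 + (T k * r) ^ 3] (mod p)"
      unfolding orbit_num.simps by (intro cong_add cong_pow Suc cof)
    also have "(T k * a k) ^ 3 + (T k * r) ^ 3 = T (Suc k) * (a k * a k * a k + r ^ 3)"
    proof -
      have "T (Suc k) = T k ^ 3" by (simp add: T_def power_mult[symmetric] mult.commute)
      then show ?thesis by (simp add: algebra_simps power3_eq_cube)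
    qed
    also have "[\<dots> = T (Suc k) * a (Suc k)] (mod p)"
    proof (rule cong_scalar_left)
      have "[a (Suc k) = a k * a k * a k + s] (mod p)"
      proof -
        have "[a (Suc k) = a k * a k mod p * a k + s] (mod p)"
          by (simp add: a_def orbit_step_def cong_def)
        also have "[a k * a k mod p * a k + s = a k * a k * a k + s] (mod p)"
          by (intro cong_add cong_mult cong_refl) (simp add: cong_def)
        finally show ?thesis .
      qed
      also have "[a k * a k * a k + s = a k * a k * a k + r ^ 3] (mod p)"
        using s by (rule cong_add_lcancel[THEN iffD2])
      finally show "[a k * a k * a k + r ^ 3 = a (Suc k)] (mod p)" by (rule cong_sym)
    qed
    finally show ?case .
  qed (simp add: a_def)
  obtain S where S: "a 2 \<in> S"
    "\<And>x. x \<in> S \<Longrightarrow> noncube_residue p (factor_form q x r) \<and> orbit_step p s (orbit_step p s x) \<in> S"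
    using orbit_avoids_cubes_invariant_set[OF avoid] by (auto simp: a_def numeral_2_eq_2)
  have "a (2 * k + 2) \<in> S" for k
  proof (induction k)
    case (Suc k)
    have "a (2 * Suc k + 2) = orbit_step p s (orbit_step p s (a (2 * k + 2)))" by (simp add: a_def)
    with Suc S(2) show ?case by simp
  qed (use S(1) in \<open>simp add: numeral_2_eq_2\<close>)
  moreover obtain k where k: "n = 2 * k + 2"
    using assms(4,5) by (metis add.commute dvdE mult_Suc_right not_gr_zero not0_implies_Suc mult_is_0)
  ultimately have good: "noncube_residue p (factor_form q (a n) r)" using S(2) by blast
  define e where "e = nat ((p - 1) div 3)"
  have p1: "p > 1" using assms(2) prime_gt_1_int by blast
  have "p = 3 * int e + 1" using assms(3) p1 unfolding e_def by (simp; presburger)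
  moreover have "T n = T (n - 1) ^ 3"
    using k by (simp add: T_def power_mult[symmetric] mult.commute)
  then have "[factor_form q (orbit_num m n) (orbit_cofactor m n)
      = (T (n - 1) ^ (if q then 2 else 1)) ^ 3 * factor_form q (a n) r] (mod p)"
    using factor_form_cong[OF num[of n] cof[of n], of q]
    unfolding factor_form_mult by (simp add: power_mult[symmetric] mult.commute)
  moreover have "\<not> p dvd m"
  proof
    assume "p dvd m"
    then have "x = 0" by (simp add: x_def)
    with inv show False by simp
  qed
  then have "\<not> p dvd T (n - 1) ^ (if q then 2 else 1)"
    unfolding T_def using assms(2) by (metis prime_dvd_power)
  moreover have "factor_form q (a n) r ^ e mod p \<noteq> 0" "factor_form q (a n) r ^ e mod p \<noteq> 1"
    using good by (auto simp: noncube_residue_def pow_mod_def e_def Let_def split: if_splits)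
  ultimately show ?thesis by (rule not_cube_of_residue[OF assms(2)])
qed

definition base_residue_works :: "bool \<Rightarrow> int \<Rightarrow> int \<Rightarrow> bool" where
  "base_residue_works q p x = (let s = x * x mod p in
     noncube_residue p (if q then (s - 1) * s + 1 else s + 1))"

lemma base_not_cube:
  assumes "base_residue_works q p (m mod p)" "prime p" "p mod 3 = 1"
  shows "factor_form q 1 (m\<^sup>2) \<noteq> y ^ 3"
proof -
  define s where "s = (m mod p) * (m mod p) mod p"
  define e where "e = nat ((p - 1) div 3)"
  have p1: "p > 1" using assms(2) prime_gt_1_int by blast
  have "p = 3 * int e + 1" using assms(3) p1 unfolding e_def by (simp; presburger)
  moreover have "[factor_form q 1 (m\<^sup>2) = factor_form q 1 s] (mod p)"
    by (intro factor_form_cong cong_refl) (simp add: s_def cong_def power2_eq_square mod_simps)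
  then have "[factor_form q 1 (m\<^sup>2) = 1 ^ 3 * factor_form q 1 s] (mod p)" by simp
  moreover have "\<not> p dvd 1" using p1 by auto
  moreover have "(if q then (s - 1) * s + 1 else s + 1) = factor_form q 1 s"
    by (simp add: factor_form_def algebra_simps power2_eq_square)
  then have "noncube_residue p (factor_form q 1 s)"
    using assms(1) unfolding base_residue_works_def s_def Let_def by metis
  then have "factor_form q 1 s ^ e mod p \<noteq> 0" "factor_form q 1 s ^ e mod p \<noteq> 1"
    by (auto simp: noncube_residue_def pow_mod_def e_def Let_def split: if_splits)
  ultimately show ?thesis by (rule not_cube_of_residue[OF assms(2)])
qed

section \<open>Sieving the integers up to a bound\<close>

fun sieve :: "int \<Rightarrow> int list \<Rightarrow> int list \<Rightarrow> int list" where
  "sieve p R [] = []"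
| "sieve p R (x # xs) = (if mem (x mod p) R then sieve p R xs else x # sieve p R xs)"

text \<open>
  The numbers \<open>c, c + M, c + 2M, ...\<close> up to \<open>N\<close>, at most one for each element of the list; the
  list serves as a counter.
\<close>

fun lift_class :: "int \<Rightarrow> int \<Rightarrow> int list \<Rightarrow> int \<Rightarrow> int list" where
  "lift_class N M [] c = []"
| "lift_class N M (k # ks) c = (if N < c then [] else c # lift_class N M ks (c + M))"

fun lift_classes :: "int \<Rightarrow> int \<Rightarrow> int list \<Rightarrow> int list \<Rightarrow> int list" where
  "lift_classes N M ks [] = []"
| "lift_classes N M ks (c # cs) = lift_class N M ks c @ lift_classes N M ks cs"

text \<open>
  The entry \<open>(p, R)\<close> removes the numbers whose residue modulo \<open>p\<close> lies in \<open>R\<close>. As long as the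
  product \<open>M\<close> of the moduli used so far is at most \<open>N\<close>, the list holds residue classes modulo \<open>M\<close>,
  so that most numbers up to \<open>N\<close> are discarded without being looked at individually; afterwards it
  holds the surviving numbers. The first equation returns all numbers if the product never exceeds
  \<open>N\<close>.
\<close>

fun survivors :: "int \<Rightarrow> int \<Rightarrow> int list \<Rightarrow> (int \<times> int list) list \<Rightarrow> int list" where
  "survivors N M cs [] = (if M \<le> N then [0..N] else cs)"
| "survivors N M cs ((p, R) # C) =
     (if M \<le> N then survivors N (M * p) (sieve p R (lift_classes N M [1..p] cs)) C
      else survivors N M (sieve p R cs) C)"

lemma set_sieve: "set (sieve p R xs) = {x \<in> set xs. x mod p \<notin> set R}"
  by (induction xs) (auto simp: mem_iff)

lemma in_lift_class:
  assumes "M > 0" "k < length ks" "c + M * int k \<le> N"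
  shows "c + M * int k \<in> set (lift_class N M ks c)"
  using assms(2,3)
proof (induction ks arbitrary: c k)
  case (Cons j ks)
  have "c \<le> c + M * int k" using assms(1) by simp
  then have "\<not> N < c" using Cons.prems(2) by linarith
  then show ?case using Cons.IH[of "k - 1" "c + M"] Cons.prems
    by (cases k) (auto simp: algebra_simps)
qed simp

lemma set_lift_classes: "set (lift_classes N M ks cs) = (\<Union>c\<in>set cs. set (lift_class N M ks c))"
  by (induction cs) auto

lemma survives_or_sieved_out:
  assumes "M > 0" "0 \<le> m" "m \<le> N" "m mod M \<in> set cs" "\<forall>(p, R)\<in>set C. p > 0"
  shows "m \<in> set (survivors N M cs C) \<or> (\<exists>(p, R)\<in>set C. m mod p \<in> set R)"
  using assms
proof (induction N M cs C rule: survivors.induct)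
  case (1 N M cs)
  then show ?case by (auto simp: mod_pos_pos_trivial)
next
  case (2 N M cs p R C)
  have p: "p > 0" using "2.prems" by simp
  show ?case
  proof (cases "m mod p \<in> set R")
    case True
    then show ?thesis by auto
  next
    case notin: False
    show ?thesis
    proof (cases "M \<le> N")
      case True
      \<comment> \<open>The two lowest digits of \<open>m\<close> in the mixed radix system with bases \<open>M\<close>, \<open>p\<close>.\<close>
      define c where "c = m mod M"
      define k where "k = nat (m div M mod p)"
      have k: "int k = m div M mod p" using p by (simp add: k_def)
      have eq: "m mod (M * p) = c + M * int k"
        using p "2.prems"(1) by (simp add: c_def k zmod_zmult2_eq)
      have "m mod (M * p) \<le> N"
        using "2.prems" p by (metis mult_pos_pos order_trans zmod_le_nonneg_dividend)
      moreover have "k < length [1..p]" using k p by (simp add: k_def nat_less_iff)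
      ultimately have "m mod (M * p) \<in> set (lift_class N M [1..p] c)"
        unfolding eq by (intro in_lift_class) (use "2.prems" in auto)
      then have "m mod (M * p) \<in> set (lift_classes N M [1..p] cs)"
        using "2.prems"(4) unfolding set_lift_classes c_def by blast
      moreover have "m mod (M * p) mod p = m mod p" by (simp add: mod_mod_cancel)
      ultimately have "m mod (M * p) \<in> set (sieve p R (lift_classes N M [1..p] cs))"
        using notin by (simp add: set_sieve)
      then show ?thesis using "2.IH"(1)[OF True] "2.prems" p True by auto
    next
      case False
      then have "m mod M = m" using "2.prems" by simp
      then have "m mod M \<in> set (sieve p R cs)" using notin "2.prems" by (simp add: set_sieve)
      then show ?thesis using "2.IH"(2)[OF False] "2.prems" False by auto
    qed
  qed
qed

text \<open>
  Trial division. The test \<open>d \<le> 1\<close> is what makes the recursion terminate: from \<open>d > 1\<close> and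
  \<open>d\<^sup>2 \<le> p\<close> it follows that \<open>d < p\<close>.
\<close>

function no_divisor_from :: "int \<Rightarrow> int \<Rightarrow> bool" where
  "no_divisor_from d p = (if p < d * d then True else if d \<le> 1 then False else if p mod d = 0 then False
     else no_divisor_from (d + 1) p)"
  by pat_completeness auto
termination
proof (relation "measure (\<lambda>(d, p). nat (p - d))", goal_cases)
  case (2 d p)
  then have "d * 1 < d * d" by (intro mult_strict_left_mono) auto
  then have "d < p" using 2 by linarith
  then show ?case by simp
qed simp
declare no_divisor_from.simps [simp del]

lemma no_divisor_from: "no_divisor_from d p \<Longrightarrow> d \<le> k \<Longrightarrow> k * k \<le> p \<Longrightarrow> d > 1 \<Longrightarrow> \<not> k dvd p"
proof (induction d p rule: no_divisor_from.induct)
  case (1 d p)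
  have "d * d \<le> k * k" using "1.prems" by (intro mult_mono) auto
  then have a: "\<not> p < d * d" "\<not> d \<le> 1" using "1.prems" by auto
  with "1.prems"(1) have b: "p mod d \<noteq> 0" "no_divisor_from (d + 1) p"
    unfolding no_divisor_from.simps[of d p] by (auto split: if_splits)
  show ?case
  proof (cases "k = d")
    case True
    then show ?thesis using b by auto
  next
    case False
    then show ?thesis using "1.IH"[OF a b(1) b(2)] "1.prems" by auto
  qed
qed

lemma prime_if_no_divisor:
  assumes "p > 1" "no_divisor_from 2 p"
  shows "prime p"
proof (rule ccontr)
  assume "\<not> prime p"
  then obtain a where a: "a \<ge> 0" "a dvd p" "a \<noteq> 1" "a \<noteq> p"
    using assms(1) unfolding prime_int_iff by blast
  from a(2) obtain b where b: "p = a * b" by (elim dvdE)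
  then have "a \<noteq> 0" "b \<noteq> 1" using a assms(1) by auto
  moreover from this have "b > 0" using a b assms(1) zero_less_mult_pos[of a b] by auto
  ultimately have ab: "p = a * b" "1 < a" "1 < b" using a b by auto
  have "\<not> k dvd p" if "1 < k" "k * k \<le> p" for k
    using no_divisor_from[OF assms(2), of k] that by simp
  moreover have "a * a \<le> p \<or> b * b \<le> p"
    using ab by (metis linorder_linear mult_left_mono mult_right_mono order_less_le zero_le_one order_trans)
  ultimately show False using ab by (metis dvd_triv_left dvd_triv_right)
qed

text \<open>
  The test \<open>W p x\<close> stands for one of the two residue checks above.
\<close>

fun sieve_valid :: "(int \<Rightarrow> int \<Rightarrow> bool) \<Rightarrow> (int \<times> int list) list \<Rightarrow> bool" where
  "sieve_valid W [] = True"
| "sieve_valid W ((p, R) # C) =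
    (if p \<le> 1 then False else if p mod 3 \<noteq> 1 then False
     else if no_divisor_from 2 p then if list_all (W p) R then sieve_valid W C else False
     else False)"

lemma sieve_validD:
  assumes "sieve_valid W C" "(p, R) \<in> set C"
  shows "prime p" "p mod 3 = 1" "\<forall>x\<in>set R. W p x"
proof -
  have "prime p \<and> p mod 3 = 1 \<and> (\<forall>x\<in>set R. W p x)"
    using assms by (induction W C rule: sieve_valid.induct)
      (auto simp: list_all_iff prime_if_no_divisor split: if_splits)
  then show "prime p" "p mod 3 = 1" "\<forall>x\<in>set R. W p x" by auto
qed

lemma sieve_prime_exists:
  assumes valid: "sieve_valid W C" and surv: "survivors N 1 [0] C = S"
    and m: "0 \<le> m" "m \<le> N" "m \<notin> set S"
  obtains p where "prime p" "p mod 3 = 1" "W p (m mod p)"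
proof -
  have "\<forall>(p, R)\<in>set C. p > 0"
    using sieve_validD(1)[OF valid] prime_gt_0_int by blast
  from survives_or_sieved_out[OF _ m(1,2) _ this, of 1 "[0]"] surv m(3)
  obtain p R where "(p, R) \<in> set C" "m mod p \<in> set R" by auto
  with sieve_validD[OF valid this(1)] that show thesis by blast
qed

text \<open>
  The tables are chosen greedily: each prime removes many of the numbers that remain, and only
  residues that still occur are listed. The first few primes have the strongest effect, so few
  residue classes survive until the moduli exceed the bound. The number \<open>0\<close> survives because it is
  not invertible in the first two tables and because \<open>factor_form q 1 0\<close> is the cube \<open>1\<close> in the
  others. In the last table \<open>1\<close> survives as well, since \<open>1 - 1\<^sup>2 + 1\<^sup>4\<close> is a cube.
\<close>

definition linear_even_sieve :: "(int \<times> int list) list" where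
  "linear_even_sieve = [
    (7, [1, 3, 4, 6]), (13, [1, 2, 3, 6, 7, 10, 11, 12]), (31, [1, 3, 4, 6, 8, 9, 10, 11, 12,
    19, 20, 21, 22, 23, 25, 27, 28, 30]), (43, [2, 5, 8, 10, 12, 13, 14, 15, 20, 23, 28, 29, 30,
    31, 33, 35, 38, 41]), (79, [2, 3, 4, 7, 8, 10, 12, 17, 22, 24, 30, 33, 35, 39, 40, 44, 46,
    49, 55, 57, 62, 67, 69, 71, 72, 75, 76, 77]), (67, [6, 8, 10, 12, 14, 17, 23, 29, 32, 35,
    38, 44, 50, 53, 55, 57, 59, 61]), (73, [6, 7, 14, 19, 22, 23, 25, 26, 34, 35, 38, 39, 47,
    48, 50, 51, 59, 66, 67]), (61, [9, 10, 13, 16, 21, 22, 27, 29, 32, 34, 39, 40, 44, 45, 48,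
    51, 52]), (103, [4, 6, 11, 25, 28, 40, 47, 57, 61, 71, 75, 77, 85, 92, 97, 99]), (19, [2, 4,
    15, 17]), (157, [3, 10, 49, 66, 95, 101, 108, 147, 150, 154]), (109, [14, 17, 43, 79, 100,
    102]), (463, [8, 103, 140, 159, 215]), (37, [20, 34]), (97, [45, 72, 73]), (367, [78, 90,
    272]), (433, [123, 232, 427]), (127, [3, 110]), (751, [534, 564]), (193, [170]), (373,
    [313]), (1429, [884])]"

lemma linear_even_sieve:
  "sieve_valid (residue_works False) linear_even_sieve"
  "survivors 10000 1 [0] linear_even_sieve = [0]"
  by code_simp+

definition quadratic_even_sieve :: "(int \<times> int list) list" where
  "quadratic_even_sieve = [
    (7, [1, 2, 3, 4, 5, 6]), (13, [1, 2, 3, 4, 6, 7, 9, 10, 11, 12]), (31, [1, 4, 7, 8, 9, 11,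
    14, 17, 20, 22, 23, 24, 27, 30]), (37, [4, 7, 9, 12, 16, 17, 18, 19, 20, 21, 25, 28, 30,
    33]), (79, [5, 6, 8, 9, 10, 21, 29, 30, 31, 37, 42, 48, 49, 50, 58, 68, 69, 70, 71, 73]),
    (97, [6, 9, 16, 21, 24, 35, 36, 52, 54, 56, 62, 73, 88]), (61, [4, 7, 8, 12, 19, 21, 25, 26,
    29, 40, 47, 49, 54, 57]), (19, [3, 5, 14, 16]), (73, [11, 35, 38, 54, 62]), (193, [2, 46,
    60, 73, 90]), (349, [66, 163, 179, 275, 292]), (283, [3, 11, 123]), (367, [161, 195]), (109,
    [17, 77]), (421, [112, 159]), (211, [110]), (463, [455]), (643, [550])]"

lemma quadratic_even_sieve:
  "sieve_valid (residue_works True) quadratic_even_sieve"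
  "survivors 10000 1 [0] quadratic_even_sieve = [0]"
  by code_simp+

definition linear_base_sieve :: "(int \<times> int list) list" where
  "linear_base_sieve = [
    (7, [1, 2, 3, 4, 5, 6]), (67, [1, 3, 4, 5, 6, 7, 8, 10, 11, 12, 13, 14, 16, 18, 22, 23, 24,
    25, 26, 27, 28, 29, 30, 32, 33, 34, 35, 37, 38, 39, 40, 41, 42, 43, 44, 45, 49, 51, 53, 54,
    55, 56, 57, 59, 60, 61, 62, 63, 64, 66]), (31, [2, 3, 4, 5, 6, 7, 8, 9, 12, 14, 15, 16, 17,
    19, 22, 23, 24, 25, 26, 27, 28, 29]), (13, [1, 3, 4, 6, 7, 9, 10, 12]), (97, [3, 4, 6, 11,
    19, 20, 21, 24, 34, 38, 43, 45, 49, 52, 57, 62, 68, 72, 83, 87, 89, 94]), (61, [5, 8, 10,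
    14, 27, 31, 35]), (37, [13, 23])]"

lemma linear_base_sieve:
  "sieve_valid (base_residue_works False) linear_base_sieve"
  "survivors 10000 1 [0] linear_base_sieve = [0]"
  by code_simp+

definition quadratic_base_sieve :: "(int \<times> int list) list" where
  "quadratic_base_sieve = [
    (7, [3, 4]), (19, [2, 3, 4, 7, 8, 9, 10, 11, 12, 15, 16, 17]), (31, [2, 3, 4, 5, 6, 7, 8,
    10, 11, 12, 13, 15, 16, 18, 19, 20, 21, 23, 24, 25, 26, 27, 28, 29]), (43, [2, 3, 4, 6, 7,
    8, 9, 11, 13, 14, 15, 16, 17, 18, 19, 20, 21, 22, 23, 24, 25, 26, 27, 28, 29, 30, 32, 34,
    35, 36, 37, 39, 40, 41]), (37, [2, 4, 5, 6, 7, 10, 11, 12, 15, 16, 17, 18, 19, 20, 21, 22,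
    26, 27, 30, 31, 32, 33, 35]), (97, [2, 8, 11, 20, 21, 25, 28, 35, 37, 38, 41, 42, 43, 55,
    57, 59, 66, 68, 70, 71, 72, 77, 80, 85, 87, 90, 94]), (67, [2, 38, 48, 52]), (61, [41]),
    (79, [34])]"

lemma quadratic_base_sieve:
  "sieve_valid (base_residue_works True) quadratic_base_sieve"
  "survivors 10000 1 [0] quadratic_base_sieve = [0, 1]"
  by code_simp+

lemma orbit_abs:
  "orbit_cofactor \<bar>m\<bar> n = orbit_cofactor m n" "orbit_num \<bar>m\<bar> n = orbit_num m n"
proof -
  show *: "orbit_cofactor \<bar>m\<bar> n = orbit_cofactor m n" for n by (induction n) simp_all
  show "orbit_num \<bar>m\<bar> n = orbit_num m n" by (induction n) (simp_all add: *)
qed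

text \<open>
  For \<open>m = 1\<close> the number \<open>factor_form True 1 (m\<^sup>2)\<close> is the cube \<open>1\<close>, so the argument for odd \<open>n\<close>
  fails. Modulo \<open>7\<close> the orbit \<open>0, 1, 2, 2, ...\<close> is constant from the second step on, and the form
  takes the value \<open>3\<close>, not a cube modulo \<open>7\<close>.
\<close>

lemma orbit_one_mod_7: "n \<ge> 2 \<Longrightarrow> [orbit_num 1 n = 2] (mod 7)"
proof (induction n rule: dec_induct)
  case base
  show ?case by (simp add: numeral_2_eq_2)
next
  case (step n)
  have "orbit_cofactor 1 n = 1" by (induction n) simp_all
  then have "orbit_num 1 (Suc n) = orbit_num 1 n ^ 3 + 1" by simp
  also have "[\<dots> = 2 ^ 3 + 1] (mod 7)" by (intro cong_add cong_pow step.IH cong_refl)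
  also have "[2 ^ 3 + 1 = 2] (mod (7::int))" by (simp add: cong_def)
  finally show ?case .
qed

lemma prime_7: "prime (7 :: int)" by simp

lemma orbit_one_not_cube:
  assumes "n \<ge> 2"
  shows "factor_form True (orbit_num 1 n) (orbit_cofactor 1 n) \<noteq> y ^ 3"
proof -
  have "orbit_cofactor 1 n = 1" by (induction n) simp_all
  then have "[factor_form True (orbit_num 1 n) (orbit_cofactor 1 n) = factor_form True 2 1] (mod 7)"
    by (intro factor_form_cong orbit_one_mod_7[OF assms]) simp
  then have "[factor_form True (orbit_num 1 n) (orbit_cofactor 1 n) = 1 ^ 3 * 3] (mod 7)"
    by (simp add: factor_form_def)
  then show ?thesis
    by (intro not_cube_of_residue[OF prime_7, where e = 2 and t = 1 and v = 3]) simp_all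
qed

text \<open>
  The excluded case is a genuine cube: \<open>1 - 1 + 1 = 1\<close>.
\<close>

lemma orbit_not_cube:
  assumes "m \<noteq> 0" "\<bar>m\<bar> \<le> 10 ^ 4" "n \<ge> 1" "\<not> (q \<and> \<bar>m\<bar> = 1 \<and> n = 1)"
  shows "factor_form q (orbit_num m n) (orbit_cofactor m n) \<noteq> y ^ 3"
proof -
  define a where "a = \<bar>m\<bar>"
  have a: "0 < a" "0 \<le> a" "a \<le> 10000" using assms(1,2) by (auto simp: a_def)
  have "factor_form q (orbit_num a n) (orbit_cofactor a n) \<noteq> y ^ 3"
  proof (cases "q \<and> a = 1")
    case True
    then show ?thesis using orbit_one_not_cube[of n] assms(3,4) by (auto simp: a_def)
  next
    case False
    show ?thesis
    proof (cases "even n")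
      case True
      have "\<exists>p. prime p \<and> p mod 3 = 1 \<and> residue_works q p (a mod p)"
      proof (cases q)
        case True
        have "a \<notin> set [0]" using a by auto
        from sieve_prime_exists[OF quadratic_even_sieve a(2,3) this] True show ?thesis by metis
      next
        case False
        with a have "a \<notin> set [0]" by auto
        from sieve_prime_exists[OF linear_even_sieve a(2,3) this] False show ?thesis by metis
      qed
      then show ?thesis using even_orbit_not_cube True assms(3) by auto
    next
      case odd: False
      have "\<exists>p. prime p \<and> p mod 3 = 1 \<and> base_residue_works q p (a mod p)"
      proof (cases q)
        case True
        with False a have "a \<notin> set [0, 1]" by auto
        from sieve_prime_exists[OF quadratic_base_sieve a(2,3) this] True show ?thesis by metis
      next
        case False
        with a have "a \<notin> set [0]" by auto
        from sieve_prime_exists[OF linear_base_sieve a(2,3) this] False show ?thesis by metis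
      qed
      then have "factor_form q 1 (a\<^sup>2) \<noteq> z ^ 3" for z using base_not_cube by blast
      then show ?thesis by (rule odd_orbit_not_cube[OF odd])
    qed
  qed
  then show ?thesis by (simp add: a_def orbit_abs)
qed

section \<open>The factors of the iterates\<close>

lemma rat_cube_eq_int:
  fixes x :: rat
  assumes "x ^ 3 = of_int k"
  obtains z where "x = of_int z" "z ^ 3 = k"
proof -
  obtain a b where ab: "quotient_of x = (a, b)" by (cases "quotient_of x")
  have b: "b > 0" and cop: "coprime a b" and x: "x = of_int a / of_int b"
    using quotient_of_denom_pos[OF ab] quotient_of_coprime[OF ab] quotient_of_div[OF ab] by auto
  have "of_int (a ^ 3) = (of_int (k * b ^ 3) :: rat)"
    using assms b by (simp add: x power_divide field_simps)
  then have "a ^ 3 = k * b ^ 3" by (simp only: of_int_eq_iff)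
  then have "b dvd a ^ 3" by (simp add: power3_eq_cube)
  moreover have "coprime b (a ^ 3)" using cop by (simp add: coprime_commute)
  ultimately have "is_unit b" by (metis coprime_common_divisor dvd_refl)
  with b have "b = 1" by simp
  with x have "x = of_int a" by simp
  moreover from this assms have "of_int (a ^ 3) = (of_int k :: rat)" by simp
  ultimately show thesis using that of_int_eq_iff by blast
qed

lemma pcompose_factor_form:
  "pcompose (factor_form q a b) h = factor_form q (pcompose a h) (pcompose b h)"
  by (simp add: factor_form_def pcompose_add pcompose_diff pcompose_mult power2_eq_square)

lemma poly_factor_form: "poly (factor_form q a b) x = factor_form q (poly a x) (poly b x)"
  by (simp add: factor_form_def)

lemma poly_iterate_commute: "pcompose (poly_iterate f n) f = pcompose f (poly_iterate f n)"
  by (induction n) (simp_all add: pcompose_idR pcompose_assoc[symmetric] pcompose_pCons)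

lemma factor_form_linear_irreducible:
  fixes r :: rat
  assumes "r \<noteq> 0"
  shows "irreducible (factor_form q [:0, 1:] [:r:])"
proof (cases q)
  case False
  then show ?thesis by (simp add: factor_form_def irreducible_linear_field_poly)
next
  case True
  define g where "g = factor_form q [:0, 1:] [:r:]"
  have g: "g = [:r\<^sup>2, - r, 1:]" using True by (simp add: g_def factor_form_def power2_eq_square)
  have no_root: "poly g x \<noteq> 0" for x
  proof -
    have "4 * poly g x = (2 * x - r)\<^sup>2 + 3 * r\<^sup>2" by (simp add: g power2_eq_square algebra_simps)
    also have "\<dots> > 0" using assms by (simp add: add_nonneg_pos)
    finally show ?thesis by simp
  qed
  have root: "\<exists>x. poly p x = 0" if "degree p = 1" for p :: "rat poly"
  proof -
    from that obtain u v where "p = [:u, v:]" "v \<noteq> 0" by (rule degree1_coeffs)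
    then show ?thesis by (intro exI[of _ "- u / v"]) simp
  qed
  have "irreducible g"
  proof (rule irreducibleI)
    show "g \<noteq> 0" "\<not> g dvd 1" by (auto simp: g is_unit_pCons_iff)
    fix a b assume ab: "g = a * b"
    then have nz: "a \<noteq> 0" "b \<noteq> 0" by (auto simp: g)
    have "degree g = 2" by (simp add: g)
    then have "degree a + degree b = 2" using degree_mult_eq[OF nz] ab by simp
    moreover have "degree a \<noteq> 1" "degree b \<noteq> 1"
      using root no_root ab by (metis mult_zero_left mult_zero_right poly_mult)+
    ultimately have "degree a = 0 \<or> degree b = 0" by linarith
    then show "a dvd 1 \<or> b dvd 1" using nz by (auto simp: is_unit_iff_degree)
  qed
  then show ?thesis by (simp add: g_def)
qed

lemma degree_monic_iterate:
  assumes "degree f = d" "d > 0" "lead_coeff f = (1 :: rat)"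
  shows "degree (poly_iterate f n) = d ^ n" "lead_coeff (poly_iterate f n) = 1"
proof -
  show deg: "degree (poly_iterate f n) = d ^ n" for n
    using assms by (induction n) (simp_all add: degree_pcompose)
  show "lead_coeff (poly_iterate f n) = 1"
  proof (induction n)
    case (Suc n)
    have "degree (poly_iterate f n) > 0" using deg assms by simp
    then show ?case using Suc assms by (simp add: lead_coeff_comp)
  qed simp
qed

lemma orbit_of_zero:
  fixes m :: int and r :: rat
  assumes "m \<noteq> 0" "r = 1 / of_int m"
  shows "of_int (orbit_cofactor m n) * r ^ (3 ^ n) = r"
    and "(poly (monom 1 3 + [:r ^ 3:]) ^^ n) 0 = of_int (orbit_num m n) * r ^ (3 ^ n)"
proof -
  show cof: "of_int (orbit_cofactor m n) * r ^ (3 ^ n) = r" for n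
  proof -
    have "of_int m * of_int (orbit_cofactor m n) = (of_int m :: rat) ^ (3 ^ n)"
      by (metis of_int_mult of_int_power times_orbit_cofactor)
    moreover have "(of_int m :: rat) ^ (3 ^ n) * r ^ (3 ^ n) = 1"
      using assms by (simp add: power_mult_distrib[symmetric])
    ultimately have "of_int m * (of_int (orbit_cofactor m n) * r ^ (3 ^ n)) = 1"
      by (simp add: mult.assoc[symmetric])
    then have "of_int (orbit_cofactor m n) * r ^ (3 ^ n) = 1 / of_int m"
      using assms(1) by (simp add: nonzero_eq_divide_eq mult.commute)
    then show ?thesis using assms(2) by simp
  qed
  define g where "g = poly (monom 1 3 + [:r ^ 3:])"
  have g: "g x = x ^ 3 + r ^ 3" for x by (simp add: g_def poly_monom)
  have "(g ^^ n) 0 = of_int (orbit_num m n) * r ^ (3 ^ n)"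
  proof (induction n)
    case (Suc n)
    have "(g ^^ Suc n) 0 = (of_int (orbit_num m n) * r ^ (3 ^ n)) ^ 3 + r ^ 3" by (simp add: Suc g)
    also have "\<dots> = (of_int (orbit_num m n) * r ^ (3 ^ n)) ^ 3
        + (of_int (orbit_cofactor m n) * r ^ (3 ^ n)) ^ 3"
      unfolding cof ..
    also have "\<dots> = of_int (orbit_num m (Suc n)) * r ^ (3 ^ Suc n)"
      by (simp add: power_mult_distrib power_mult[symmetric] mult.commute[of _ 3] distrib_right)
    finally show ?case .
  qed simp
  then show "(poly (monom 1 3 + [:r ^ 3:]) ^^ n) 0 = of_int (orbit_num m n) * r ^ (3 ^ n)"
    by (simp only: g_def)
qed

text \<open>
  Up to the cube of a nonzero rational, the value is \<open>factor_form q A\<^sub>n B\<^sub>n\<close>: the common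
  denominator \<open>m^(3^n)\<close> of \<open>a\<^sub>n\<close> and \<open>r\<close> is a cube because \<open>n \<ge> 1\<close>.
\<close>

lemma factor_of_iterate_value_not_cube:
  fixes m :: int and r y :: rat
  assumes "m \<noteq> 0" "r = 1 / of_int m" "\<bar>m\<bar> \<le> 10 ^ 4" "n \<ge> 1" "\<not> (q \<and> \<bar>m\<bar> = 1 \<and> n = 1)"
  shows "factor_form q ((poly (monom 1 3 + [:r ^ 3:]) ^^ n) 0) r \<noteq> y ^ 3"
proof
  define A B where "A = orbit_num m n" and "B = orbit_cofactor m n"
  define d :: nat where "d = (if q then 2 else 1)"
  define u where "u = (r ^ (3 ^ (n - 1))) ^ d"
  assume "factor_form q ((poly (monom 1 3 + [:r ^ 3:]) ^^ n) 0) r = y ^ 3"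
  also have "(poly (monom 1 3 + [:r ^ 3:]) ^^ n) 0 = r ^ (3 ^ n) * of_int A"
    using orbit_of_zero(2)[OF assms(1,2)] by (simp add: A_def)
  also have "factor_form q (r ^ (3 ^ n) * of_int A) r
      = factor_form q (r ^ (3 ^ n) * of_int A) (r ^ (3 ^ n) * of_int B)"
    using orbit_of_zero(1)[OF assms(1,2), of n] by (simp add: B_def mult.commute)
  also have "\<dots> = (r ^ (3 ^ n)) ^ d * of_int (factor_form q A B)"
    unfolding factor_form_mult d_def by (simp add: factor_form_def)
  also have "(r ^ (3 ^ n)) ^ d = u ^ 3"
    using assms(4) by (cases n) (simp_all add: u_def power_mult[symmetric] mult_ac)
  finally have "u ^ 3 * of_int (factor_form q A B) = y ^ 3" .
  moreover have "u \<noteq> 0" using assms by (simp add: u_def)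
  ultimately have "(y / u) ^ 3 = of_int (factor_form q A B)" by (simp add: power_divide field_simps)
  then obtain z where "z ^ 3 = factor_form q A B" by (rule rat_cube_eq_int)
  then show False using orbit_not_cube[OF assms(1,3,4,5), of z] by (simp add: A_def B_def)
qed

text \<open>
  Clearing denominators gives \<open>a\<^sup>3 - 3ab\<^sup>2 = \<plusminus>b\<^sup>3\<close> with \<open>a\<close>, \<open>b\<close> coprime. Both sides have the same
  parity only if \<open>a\<close> and \<open>b\<close> are both even.
\<close>

lemma depressed_cubic_no_rational_root:
  fixes t r :: rat
  assumes "\<bar>r\<bar> = 1"
  shows "t ^ 3 - 3 * t \<noteq> r"
proof
  assume eq: "t ^ 3 - 3 * t = r"
  obtain a b where ab: "quotient_of t = (a, b)" by (cases "quotient_of t")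
  have b: "b > 0" and cop: "coprime a b" and t: "t = of_int a / of_int b"
    using quotient_of_denom_pos[OF ab] quotient_of_coprime[OF ab] quotient_of_div[OF ab] by auto
  have r: "r = of_int (if r = 1 then 1 else - 1)" using assms by auto
  define e :: int where "e = (if r = 1 then 1 else - 1)"
  have "of_int (a ^ 3 - 3 * a * b ^ 2) = (of_int (e * b ^ 3) :: rat)"
    using eq b unfolding t e_def[symmetric] r[folded e_def]
    by (simp add: field_simps power2_eq_square power3_eq_cube)
  then have "a ^ 3 - 3 * a * b ^ 2 = e * b ^ 3" by (simp only: of_int_eq_iff)
  moreover have "odd e" by (simp add: e_def)
  ultimately have "even (a ^ 3 - 3 * a * b ^ 2) \<longleftrightarrow> even b" by simp
  then have "even a" "even b" by (auto simp: even_diff)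
  with cop show False by (metis coprime_common_divisor odd_one)
qed

text \<open>
  For \<open>r = 1\<close> this polynomial is \<open>z\<^sup>6 + z\<^sup>3 + 1\<close>, the ninth cyclotomic polynomial. The value that
  decides irreducibility is the cube \<open>1\<close> here, so more than the constant term of the norm is
  needed: a factor \<open>ax\<^sup>2 + bx + c\<close> whose norm is proportional to \<open>x\<^sup>2 + rx + 1\<close> has \<open>c = a\<close>, and then
  \<open>b/a\<close> is a rational root of \<open>t\<^sup>3 - 3t = r\<close>.
\<close>

lemma irreducible_quadratic_factor_second_iterate:
  fixes r :: rat
  assumes "\<bar>r\<bar> = 1"
  shows "irreducible (factor_form True (monom 1 3 + [:r ^ 3:]) [:r:])"
proof (rule ccontr)
  define g where "g = factor_form True [:0, 1:] [:r:]"
  define s where "s = r ^ 3"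
  have r: "r * r = 1" "r ^ 3 = r" "r \<noteq> 0"
    using assms by (auto simp: abs_if power3_eq_cube split: if_splits)
  have g: "g = [:1, - r, 1:]"
    by (simp add: g_def factor_form_def power2_eq_square r)
  have "irreducible g" unfolding g_def using r by (intro factor_form_linear_irreducible)
  moreover assume "\<not> irreducible (factor_form True (monom 1 3 + [:r ^ 3:]) [:r:])"
  then have "\<not> irreducible (pcompose g (monom 1 3 + [:s:]))"
    unfolding g_def s_def pcompose_factor_form by (simp add: pcompose_pCons)
  ultimately obtain h where h: "h \<noteq> 0" "degree h = degree g"
    and eq: "smult (lead_coeff g) (cubic_norm h) = smult (lead_coeff h ^ 3) (pcompose g [:s, 1:])"
    by (rule reducible_pcompose_cube_plus)
  have dh: "degree h = 2" using h(2) by (simp add: g)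
  define a b c where "a = coeff h 2" and "b = coeff h 1" and "c = coeff h 0"
  have a: "a \<noteq> 0" using h(1) dh unfolding a_def by (metis leading_coeff_0_iff)
  have tri: "trisect 0 h = [:c:]" "trisect 1 h = [:b:]" "trisect 2 h = [:a:]"
    using dh by (auto simp: poly_eq_iff coeff_trisect coeff_pCons a_def b_def c_def coeff_eq_0
        numeral_2_eq_2 split: nat.split)
  have norm: "cubic_norm h = [:c ^ 3, b ^ 3 - 3 * a * b * c, a ^ 3:]"
    unfolding cubic_norm_def tri by (simp add: power2_eq_square power3_eq_cube numeral_poly algebra_simps)
  have shift: "pcompose g [:s, 1:] = [:1, r, 1:]"
    using r by (simp add: g s_def pcompose_pCons)
  have "lead_coeff g = 1" by (simp add: g)
  then have coeffs: "c ^ 3 = a ^ 3" "b ^ 3 - 3 * a * b * c = a ^ 3 * r"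
    using eq unfolding norm shift dh a_def[symmetric] by simp_all
  have "(2 * c + a)\<^sup>2 + 3 * a\<^sup>2 > 0" using a by (simp add: add_nonneg_pos)
  moreover have "(c - a) * ((2 * c + a)\<^sup>2 + 3 * a\<^sup>2) = 4 * (c ^ 3 - a ^ 3)"
    by (simp add: power2_eq_square power3_eq_cube algebra_simps)
  ultimately have "c = a" using coeffs(1) by simp
  with coeffs(2) a have "(b / a) ^ 3 - 3 * (b / a) = r"
    by (simp add: field_simps power2_eq_square power3_eq_cube)
  with depressed_cubic_no_rational_root[OF assms] show False by blast
qed

text \<open>
  Induction on \<open>n\<close>: composing with \<open>f\<close> preserves irreducibility unless the value at \<open>f(0) = r\<^sup>3\<close>
  is a cube, and that value is the form at the next point of the orbit of \<open>0\<close>.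
\<close>

lemma irreducible_factor_of_iterate:
  fixes m :: int and r :: rat
  assumes m: "m \<noteq> 0" "\<bar>m\<bar> \<le> 10 ^ 4" and r: "r = 1 / of_int m"
  shows "irreducible (factor_form q (poly_iterate (monom 1 3 + [:r ^ 3:]) n) [:r:])"
proof (induction n)
  case 0
  show ?case using m r by (simp add: factor_form_linear_irreducible)
next
  case (Suc n)
  define f where "f = monom 1 3 + [:r ^ 3:]"
  define p where "p = factor_form q (poly_iterate f n) [:r:]"
  have f: "degree f = 3" "lead_coeff f = 1"
    by (simp_all add: f_def degree_add_eq_left degree_monom_eq coeff_pCons)
  have step: "pcompose p f = factor_form q (poly_iterate f (Suc n)) [:r:]"
    by (simp add: p_def pcompose_factor_form poly_iterate_commute)
  show ?case
  proof (cases "q \<and> \<bar>m\<bar> = 1 \<and> n = 0")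
    case True
    then have "\<bar>r\<bar> = 1" by (auto simp: r abs_if split: if_splits)
    then show ?thesis
      using irreducible_quadratic_factor_second_iterate[of r] True by (simp add: pcompose_idR)
  next
    case False
    have "p = pcompose (factor_form q [:0, 1:] [:r:]) (poly_iterate f n)"
      by (simp add: p_def pcompose_factor_form pcompose_pCons)
    moreover have "lead_coeff (factor_form q [:0, 1:] [:r:]) = 1"
      by (cases q) (simp_all add: factor_form_def power2_eq_square)
    ultimately have monic: "lead_coeff p = 1"
      using degree_monic_iterate[OF f(1) _ f(2), of n] by (simp add: lead_coeff_comp)
    have "poly p (r ^ 3) = factor_form q ((poly f ^^ Suc n) 0) r"
      by (simp add: p_def poly_factor_form poly_poly_iterate funpow_swap1) (simp add: f_def poly_monom)
    then have "poly p (r ^ 3) \<noteq> y ^ 3" for y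
      using factor_of_iterate_value_not_cube[OF m(1) r m(2), of "Suc n" q y] False by (auto simp: f_def)
    then have "irreducible (pcompose p (monom 1 3 + [:r ^ 3:]))"
      using Suc monic by (intro irreducible_pcompose_cube_plus) (simp_all add: p_def f_def)
    then show ?thesis using step by (simp only: f_def)
  qed
qed

text \<open>
  The irreducible polynomial \<open>z\<close> composed with \<open>f\<close> is \<open>f\<close>; its value at \<open>1/c\<close> is \<open>1/c\<close>.
\<close>

lemma reducible_imp_cube:
  fixes c :: int
  assumes "c \<noteq> 0" "\<not> irreducible (monom 1 3 + [:1 / of_int c:] :: rat poly)"
  obtains m where "c = m ^ 3" "m \<noteq> 0"
proof -
  have "irreducible [:0, 1 :: rat:]" by (intro irreducible_linear_field_poly) simp
  then have "\<exists>y :: rat. poly [:0, 1:] (1 / of_int c) = y ^ 3"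
    using irreducible_pcompose_cube_plus[of "[:0, 1:]" "1 / of_int c :: rat"] assms(2)
    by (auto simp: pcompose_pCons)
  then obtain y :: rat where y: "1 / of_int c = y ^ 3" by auto
  have "(1 / y) ^ 3 = of_int c" by (simp add: power_one_over y[symmetric])
  then obtain m where "m ^ 3 = c" by (rule rat_cube_eq_int)
  with that assms(1) show thesis by auto
qed

theorem theorem3:
  fixes c :: int and f :: "rat poly"
  assumes "c \<noteq> 0"
    and "\<bar>c\<bar> \<le> 10 ^ 12"
    and "f = monom 1 3 + [:1 / of_int c:]"
    and "\<not> irreducible f"
  shows "\<forall>n\<ge>1. exactly_two_irreducible_factors (poly_iterate f n)"
proof (intro allI impI)
  fix n :: nat assume "n \<ge> 1"
  then obtain k where n: "n = Suc k" by (cases n) auto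
  obtain m where m: "c = m ^ 3" "m \<noteq> 0" using reducible_imp_cube assms by metis
  have "\<bar>m\<bar> ^ 3 \<le> (10 ^ 4) ^ 3" using assms(2) by (simp add: m(1) power_abs)
  then have m_le: "\<bar>m\<bar> \<le> 10 ^ 4" by (rule power_le_imp_le_base[of _ 2, simplified]) simp
  define r :: rat where "r = 1 / of_int m"
  have f: "f = monom 1 3 + [:r ^ 3:]" by (simp add: assms(3) m(1) r_def power_divide)
  define F where "F = poly_iterate f k"
  define G where "G q = factor_form q F [:r:]" for q
  have irr: "irreducible (G q)" for q
    unfolding G_def F_def f by (rule irreducible_factor_of_iterate[OF m(2) m_le r_def])
  have deg_F: "degree F = 3 ^ k"
    unfolding F_def by (rule degree_monic_iterate(1))
      (simp_all add: f degree_add_eq_left degree_monom_eq coeff_pCons)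
  have G: "G q = pcompose (factor_form q [:0, 1:] [:r:]) F" for q
    by (simp add: G_def pcompose_factor_form pcompose_pCons)
  have deg_G: "degree (G q) = (if q then 2 else 1) * 3 ^ k" for q
    unfolding G degree_pcompose deg_F
    by (cases q) (simp_all add: factor_form_def power2_eq_square)
  have "poly_iterate f n = G False * G True"
  proof -
    have "pcompose f F = F ^ 3 + [:r:] ^ 3"
      unfolding f by (simp add: pcompose_add power3_eq_cube monom_altdef pcompose_mult pcompose_pCons)
    then show ?thesis by (simp add: G_def factor_form_mult_forms n F_def)
  qed
  moreover have "\<not> G False dvd G True"
  proof
    assume "G False dvd G True"
    then have "G True dvd G False"
      using irreducibleD'[OF irr] irreducible_not_unit[OF irr] by blast
    then have "degree (G True) \<le> degree (G False)"
      using irr by (intro dvd_imp_degree_le) (auto simp: irreducible_def)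
    then show False by (simp add: deg_G)
  qed
  ultimately show "exactly_two_irreducible_factors (poly_iterate f n)"
    unfolding exactly_two_irreducible_factors_def
    by (intro exI[of _ "G False"] exI[of _ "G True"] conjI irr)
qed

end
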